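(* Consider the following system of ordinary differential equations for functions $q_0,q_1,x_0,x_1,x_2,y_{0,0},y_{0,1},y_{1,0},y_{1,1}$ of $t\ge 0$, where $q=q_0+q_1$ and $y=y_{0,0}+y_{0,1}+y_{1,0}+y_{1,1}$: $$\frac{dq_0}{dt}=-y_{0,0}-y_{1,0},\qquad \frac{dq_1}{dt}=-y_{0,1}-y_{1,1}+\frac{(q_0-2q_1)y_{0,0}}{q},$$ $$\frac{dx_0}{dt}=-\frac{2x_0y}{q},\qquad \frac{dx_1}{dt}=\frac{2x_0y_{0,0}-2x_1(y+y_{0,0})}{q},\qquad \frac{dx_2}{dt}=\frac{x_1y_{0,0}-2x_2(y+2y_{0,0})}{q},$$ $$\frac{dy_{0,0}}{dt}=\frac{2x_0-y_{0,0}(y_{0,0}+y)}{q},\qquad \frac{dy_{0,1}}{dt}=\frac{x_1+y_{0,0}^2-y_{0,1}(y+3y_{0,0})}{q},$$ $$\frac{dy_{1,0}}{dt}=\frac{x_1+y_{0,0}^2-y_{1,0}y}{q},\qquad \frac{dy_{1,1}}{dt}=\frac{2x_2+y_{0,1}y_{0,0}+y_{1,0}y_{0,0}-y_{1,1}(y+2y_{0,0})}{q},$$ with initial conditions $q_0(0)=\tfrac12$, $q_1(0)=0$, $x_0(0)=1$, $x_1(0)=x_2(0)=0$, and $y_{k,l}(0)=0$ for all $k,l\in\{0,1\}$. This initial value problem has the unique solution $$q_0(t)=\tfrac12e^{-4t^2},\qquad q_1(t)=\tfrac12\cdot 4r(t)^2e^{-4t^2},$$ $$x_0(t)=e^{-8t^2},\qquad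 x_1(t)=8r(t)^2e^{-8t^2},\qquad x_2(t)=16r(t)^4e^{-8t^2},$$ $$y_{0,0}(t)=4r(t)e^{-4t^2},\qquad y_{0,1}(t)=16r(t)^3e^{-4t^2},$$ $$y_{1,0}(t)=4(t-r(t))e^{-4t^2},\qquad y_{1,1}(t)=16r(t)^2(t-r(t))e^{-4t^2},$$ where $r(t)$ satisfies $8t+4r(t)-3\sqrt2\,\mathrm{arctanh}(2\sqrt2\, r(t))=0$.
   Context: The function $r:[0,\infty)\to[0,\tfrac1{2\sqrt2})$ is the solution of $\frac{dr}{dt}=\frac{1-8r^2}{1+4r^2}$ with $r(0)=0$; equivalently, it is given implicitly by $8t+4r(t)-3\sqrt2\,\mathrm{arctanh}(2\sqrt2\,r(t))=0$. *)

theory Defs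
  imports Complex_Main
begin

definition r_range :: "(real \<Rightarrow> real) \<Rightarrow> bool" where
  "r_range r \<longleftrightarrow> (\<forall>t\<ge>0. 0 \<le> r t \<and> r t < 1 / (2 * sqrt 2))"

definition r_ode :: "(real \<Rightarrow> real) \<Rightarrow> bool" where
  "r_ode r \<longleftrightarrow> r_range r \<and> r 0 = 0 \<and>
     (\<forall>t\<ge>0. (r has_real_derivative (1 - 8 * (r t)\<^sup>2) / (1 + 4 * (r t)\<^sup>2)) (at t within {0..}))"

definition r_implicit :: "(real \<Rightarrow> real) \<Rightarrow> bool" where
  "r_implicit r \<longleftrightarrow> r_range r \<and>
     (\<forall>t\<ge>0. 8 * t + 4 * r t - 3 * sqrt 2 * artanh (2 * sqrt 2 * r t) = 0)"

(* Only the values at t >= 0 matter, and the derivative at 0 is one-sided. The right-hand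
   sides make sense only for q \<noteq> 0, so a solution is required to stay in that domain;
   this also keeps the convention x / 0 = 0 from playing any role. *)
definition ivp_solution ::
  "(real \<Rightarrow> real) \<Rightarrow> (real \<Rightarrow> real) \<Rightarrow>
   (real \<Rightarrow> real) \<Rightarrow> (real \<Rightarrow> real) \<Rightarrow> (real \<Rightarrow> real) \<Rightarrow>
   (real \<Rightarrow> real) \<Rightarrow> (real \<Rightarrow> real) \<Rightarrow> (real \<Rightarrow> real) \<Rightarrow> (real \<Rightarrow> real) \<Rightarrow> bool"
where
  "ivp_solution q0 q1 x0 x1 x2 y00 y01 y10 y11 \<longleftrightarrow>
     q0 0 = 1 / 2 \<and> q1 0 = 0 \<and>
     x0 0 = 1 \<and> x1 0 = 0 \<and> x2 0 = 0 \<and>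
     y00 0 = 0 \<and> y01 0 = 0 \<and> y10 0 = 0 \<and> y11 0 = 0 \<and>
     (\<forall>t\<ge>0.
        let q = q0 t + q1 t; y = y00 t + y01 t + y10 t + y11 t; F = at t within {0..} in
        q \<noteq> 0 \<and>
        (q0 has_real_derivative - y00 t - y10 t) F \<and>
        (q1 has_real_derivative - y01 t - y11 t + (q0 t - 2 * q1 t) * y00 t / q) F \<and>
        (x0 has_real_derivative - (2 * x0 t * y / q)) F \<and>
        (x1 has_real_derivative (2 * x0 t * y00 t - 2 * x1 t * (y + y00 t)) / q) F \<and>
        (x2 has_real_derivative (x1 t * y00 t - 2 * x2 t * (y + 2 * y00 t)) / q) F \<and>
        (y00 has_real_derivative (2 * x0 t - y00 t * (y00 t + y)) / q) F \<and>
        (y01 has_real_derivative (x1 t + (y00 t)\<^sup>2 - y01 t * (y + 3 * y00 t)) / q) F \<and>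
        (y10 has_real_derivative (x1 t + (y00 t)\<^sup>2 - y10 t * y) / q) F \<and>
        (y11 has_real_derivative
           (2 * x2 t + y01 t * y00 t + y10 t * y00 t - y11 t * (y + 2 * y00 t)) / q) F)"

end

theory Submission
  imports Defs "HOL-Analysis.Analysis"
begin

text \<open>Write \<open>v = y / q\<close> and \<open>s = x\<^sub>1 / (2 x\<^sub>0)\<close>. For any solution of the initial value problem, each of
  \<open>x\<^sub>1\<^sup>2 - 4 x\<^sub>0 x\<^sub>2\<close>, \<open>y\<^sub>0\<^sub>1 - s y\<^sub>0\<^sub>0\<close>, \<open>y\<^sub>1\<^sub>1 - s y\<^sub>1\<^sub>0\<close>, \<open>q\<^sub>1 - s q\<^sub>0\<close>, \<open>x\<^sub>0 - 4 q\<^sub>0\<^sup>2\<close> and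
  \<open>v - 8 t\<close> satisfies, given that the preceding ones vanish, a homogeneous linear equation
  \<open>f' = a f\<close> with continuous \<open>a\<close> and \<open>f(0) = 0\<close>, and hence vanishes identically. This
  determines everything up to \<open>r = y\<^sub>0\<^sub>0 / (8 q\<^sub>0)\<close>; the same principle applied to
  \<open>s - 4 r\<^sup>2\<close> yields the scalar equation for \<open>r\<close>, which has the implicit form as its
  first integral.\<close>

section \<open>Homogeneous linear scalar equations on the half-line\<close>

text \<open>Integrating factor: if \<open>g' = a\<close> on \<open>{0..t}\<close>, then
  \<open>f * exp (- g)\<close> has derivative 0. Only the positivity of the exponential factor is
  used later, so its exponent may stay anonymous.\<close>

lemma linear_ode_solution:
  fixes f a :: "real \<Rightarrow> real"
  assumes a: "continuous_on {0..} a"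
    and f: "\<And>t. 0 \<le> t \<Longrightarrow> (f has_real_derivative a t * f t) (at t within {0..})"
    and t: "0 \<le> t"
  shows "\<exists>c. f t = f 0 * exp c"
proof -
  have "continuous_on {0..t} a"
    using a by (rule continuous_on_subset) auto
  then obtain g where g: "\<And>x. x \<in> {0..t} \<Longrightarrow> (g has_vector_derivative a x) (at x within {0..t})"
    using antiderivative_continuous by blast
  have "((\<lambda>x. f x * exp (- g x)) has_real_derivative 0) (at x within {0..t})" if "x \<in> {0..t}" for x
  proof -
    have *: "(f has_real_derivative a x * f x) (at x within {0..t})"
      using f[of x] that by (auto intro: has_field_derivative_subset)
    have **: "(g has_real_derivative a x) (at x within {0..t})"
      using g[OF that] by (simp add: has_real_derivative_iff_has_vector_derivative)
    show ?thesis
      by (rule derivative_eq_intros * ** refl | simp)+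
  qed
  then obtain k where k: "\<And>x. x \<in> {0..t} \<Longrightarrow> f x * exp (- g x) = k"
    using has_field_derivative_zero_constant[of "{0..t}" "\<lambda>x. f x * exp (- g x)"] by auto
  have "f t * exp (- g t) = f 0 * exp (- g 0)"
    using k t by simp
  then have "f t = f 0 * exp (g t - g 0)"
    by (simp add: exp_minus exp_diff field_simps)
  then show ?thesis ..
qed

lemma linear_ode_zero:
  fixes f a :: "real \<Rightarrow> real"
  assumes "continuous_on {0..} a"
    and "\<And>t. 0 \<le> t \<Longrightarrow> (f has_real_derivative a t * f t) (at t within {0..})"
    and "f 0 = 0" "0 \<le> t"
  shows "f t = 0"
  using linear_ode_solution[OF assms(1,2,4)] assms(3) by auto

lemma linear_ode_pos:
  fixes f a :: "real \<Rightarrow> real"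
  assumes "continuous_on {0..} a"
    and "\<And>t. 0 \<le> t \<Longrightarrow> (f has_real_derivative a t * f t) (at t within {0..})"
    and "0 < f 0" "0 \<le> t"
  shows "0 < f t"
  using linear_ode_solution[OF assms(1,2,4)] assms(3) by auto

section \<open>Closed form of r via the inverse of \<open>arc_fun\<close>\<close>

text \<open>Substituting \<open>r = tanh z / (2 \<surd>2)\<close> turns the implicit equation into \<open>arc_fun z = 8 t\<close>,
  where \<open>arc_fun\<close> is a diffeomorphism of the whole real line.\<close>

definition arc_fun :: "real \<Rightarrow> real" where
  "arc_fun z = 3 * sqrt 2 * z - sqrt 2 * tanh z"

definition arc_inv :: "real \<Rightarrow> real" where
  "arc_inv = inv arc_fun"

text \<open>From \<open>tanh' = 1 - tanh^2\<close> the bracket is \<open>3 - (1 - tanh^2)\<close>.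
  It is at least 2, which yields both monotonicity and a differentiable inverse.\<close>

lemma has_real_derivative_arc_fun:
  "(arc_fun has_real_derivative sqrt 2 * (2 + (tanh z)\<^sup>2)) (at z)"
  unfolding arc_fun_def
  by (auto intro!: derivative_eq_intros simp: algebra_simps)

lemma strict_mono_arc_fun: "strict_mono arc_fun"
proof (rule strict_monoI)
  fix x y :: real
  assume "x < y"
  then show "arc_fun x < arc_fun y"
  proof (rule DERIV_pos_imp_increasing)
    fix z :: real
    have "sqrt 2 * (2 + (tanh z)\<^sup>2) > 0"
      by (intro mult_pos_pos add_pos_nonneg) auto
    then show "\<exists>D. DERIV arc_fun z :> D \<and> 0 < D"
      using has_real_derivative_arc_fun by blast
  qed
qed

lemma isCont_arc_fun: "isCont arc_fun z"
  using has_real_derivative_arc_fun DERIV_isCont by blast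

lemma surj_arc_fun: "surj arc_fun"
proof (unfold surj_def, rule allI)
  fix t :: real
  \<comment> \<open>As \<open>tanh\<close> is below 1, \<open>arc_fun ?m\<close> exceeds
    \<open>3 * sqrt 2 * ?m - sqrt 2\<close>, hence |t|. Oddness gives the matching lower bound for
    the intermediate value theorem.\<close>
  let ?m = "\<bar>t\<bar> + 1"
  have bound: "\<bar>t\<bar> \<le> arc_fun ?m"
  proof -
    have "\<bar>t\<bar> \<le> sqrt 2 * \<bar>t\<bar>"
      using mult_right_mono[of 1 "sqrt 2" "\<bar>t\<bar>"] by simp
    moreover have "sqrt 2 * tanh ?m \<le> sqrt 2 * 1"
      using tanh_real_lt_1[of ?m] by (intro mult_left_mono) auto
    moreover have "arc_fun ?m = 3 * (sqrt 2 * \<bar>t\<bar>) + 3 * sqrt 2 - sqrt 2 * tanh ?m"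
      by (simp add: arc_fun_def algebra_simps)
    moreover have "0 \<le> sqrt 2 * \<bar>t\<bar>" "0 < sqrt 2"
      by auto
    ultimately show ?thesis
      by linarith
  qed
  have "arc_fun (- ?m) = - arc_fun ?m"
    unfolding arc_fun_def tanh_minus by (simp only: mult_minus_right)
  then have "arc_fun (- ?m) \<le> t" "t \<le> arc_fun ?m"
    using bound by linarith+
  then show "\<exists>z. t = arc_fun z"
    using IVT[of arc_fun "- ?m" t ?m] isCont_arc_fun by force
qed

lemma arc_fun_arc_inv [simp]: "arc_fun (arc_inv t) = t"
  unfolding arc_inv_def using surj_arc_fun by (rule surj_f_inv_f)

lemma arc_inv_arc_fun [simp]: "arc_inv (arc_fun z) = z"
  unfolding arc_inv_def using strict_mono_arc_fun
  by (intro inv_f_f strict_mono_imp_inj_on)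

lemma arc_inv_0 [simp]: "arc_inv 0 = 0"
  using arc_inv_arc_fun[of 0] by (simp add: arc_fun_def)

lemma arc_inv_nonneg: "0 \<le> t \<Longrightarrow> 0 \<le> arc_inv t"
  using strict_mono_less_eq[OF strict_mono_arc_fun, of 0 "arc_inv t"]
  by (simp add: arc_fun_def[of 0])

lemma isCont_arc_inv: "isCont arc_inv t"
  using isCont_inverse_function[of 1 "arc_inv t" arc_inv arc_fun] isCont_arc_fun by simp

lemma has_real_derivative_arc_inv:
  "(arc_inv has_real_derivative inverse (sqrt 2 * (2 + (tanh (arc_inv t))\<^sup>2))) (at t)"
proof (rule DERIV_inverse_function[where f = arc_fun and a = "t - 1" and b = "t + 1"])
  show "sqrt 2 * (2 + (tanh (arc_inv t))\<^sup>2) \<noteq> 0"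
    using zero_le_power2[of "tanh (arc_inv t)"]
    by (metis add_nonneg_eq_0_iff mult_eq_0_iff real_sqrt_eq_zero_cancel_iff zero_le_numeral zero_neq_numeral)
qed (auto simp: isCont_arc_inv has_real_derivative_arc_fun)

text \<open>Reference solution on the whole line, so its derivative is two-sided even at 0. Both
  descriptions of r are compared with it on t >= 0.\<close>

definition r_sol :: "real \<Rightarrow> real" where
  "r_sol t = tanh (arc_inv (8 * t)) / (2 * sqrt 2)"

lemma r_sol_range: "r_range r_sol"
  unfolding r_range_def r_sol_def
  by (auto simp: divide_simps arc_inv_nonneg tanh_real_lt_1)

lemma r_sol_0 [simp]: "r_sol 0 = 0"
  by (simp add: r_sol_def)

text \<open>With \<open>T = tanh (arc_inv (8 * t))\<close> the chain rule gives
  \<open>2 (1 - T^2) / (2 + T^2)\<close>, and \<open>T^2 = 8 r^2\<close>.\<close>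

lemma r_sol_has_real_derivative:
  "(r_sol has_real_derivative (1 - 8 * (r_sol t)\<^sup>2) / (1 + 4 * (r_sol t)\<^sup>2)) (at t)"
proof -
  let ?T = "tanh (arc_inv (8 * t))"
  have sq: "8 * (r_sol t)\<^sup>2 = ?T\<^sup>2"
    by (simp add: r_sol_def power_divide power_mult_distrib)
  have pos: "0 < 2 + ?T\<^sup>2"
    by (simp add: add_pos_nonneg)
  have "((\<lambda>t. arc_inv (8 * t)) has_real_derivative inverse (sqrt 2 * (2 + ?T\<^sup>2)) * 8) (at t)"
    by (rule DERIV_chain2[OF has_real_derivative_arc_inv]) (auto intro!: derivative_eq_intros)
  then have "(r_sol has_real_derivative
      (1 - ?T\<^sup>2) * (inverse (sqrt 2 * (2 + ?T\<^sup>2)) * 8) / (2 * sqrt 2)) (at t)"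
    unfolding r_sol_def[abs_def]
    by (intro DERIV_cdivide) (auto intro!: derivative_eq_intros)
  moreover have "(1 - ?T\<^sup>2) * (inverse (sqrt 2 * (2 + ?T\<^sup>2)) * 8) / (2 * sqrt 2)
      = (1 - 8 * (r_sol t)\<^sup>2) / (1 + 4 * (r_sol t)\<^sup>2)"
  proof -
    have p: "1 + 4 * (r_sol t)\<^sup>2 = (2 + ?T\<^sup>2) / 2"
      using sq by simp
    have "sqrt 2 * (2 + ?T\<^sup>2) * (2 * sqrt 2) = 4 * (2 + ?T\<^sup>2)"
      by (simp add: algebra_simps)
    then show ?thesis
      unfolding sq p using pos by (simp add: divide_simps) (simp add: algebra_simps)
  qed
  ultimately show ?thesis
    by simp
qed

section \<open>Equivalence of the implicit and differential descriptions of r\<close>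

lemma tanh_artanh_real:
  fixes v :: real
  assumes "\<bar>v\<bar> < 1"
  shows "tanh (artanh v) = v"
proof -
  have pos: "0 < (1 + v) / (1 - v)" "0 < 1 - v" "0 < 1 + v"
    using assms by auto
  have e: "exp (- 2 * artanh v) = (1 - v) / (1 + v)"
    using pos by (simp add: artanh_def exp_minus)
  have "1 - (1 - v) / (1 + v) = 2 * v / (1 + v)" "1 + (1 - v) / (1 + v) = 2 / (1 + v)"
    using pos by (simp_all add: field_simps)
  then show ?thesis
    unfolding tanh_real_altdef e using pos by simp
qed

text \<open>The range condition places \<open>2 * sqrt 2 * r t\<close> in [0,1), where
  \<open>tanh\<close> undoes \<open>artanh\<close>; injectivity of \<open>arc_fun\<close> then
  determines the value.\<close>

lemma r_implicit_iff: "r_implicit r \<longleftrightarrow> (\<forall>t\<ge>0. r t = r_sol t)"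
proof
  assume r: "r_implicit r"
  show "\<forall>t\<ge>0. r t = r_sol t"
  proof (intro allI impI)
    fix t :: real
    assume t: "0 \<le> t"
    let ?z = "artanh (2 * sqrt 2 * r t)"
    have "0 \<le> r t" "r t < 1 / (2 * sqrt 2)" and eq: "8 * t + 4 * r t - 3 * sqrt 2 * ?z = 0"
      using r t by (auto simp: r_implicit_def r_range_def)
    then have "0 \<le> 2 * sqrt 2 * r t" "2 * sqrt 2 * r t < 1"
      by (auto simp: field_simps)
    then have tanh: "tanh ?z = 2 * sqrt 2 * r t"
      by (intro tanh_artanh_real) auto
    then have "arc_fun ?z = 8 * t"
      using eq by (simp add: arc_fun_def algebra_simps)
    then have "?z = arc_inv (8 * t)"
      by (metis arc_inv_arc_fun)
    then show "r t = r_sol t"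
      using tanh by (simp add: r_sol_def)
  qed
next
  assume r: "\<forall>t\<ge>0. r t = r_sol t"
  have "8 * t + 4 * r_sol t - 3 * sqrt 2 * artanh (2 * sqrt 2 * r_sol t) = 0" for t
  proof -
    let ?z = "arc_inv (8 * t)"
    have "2 * sqrt 2 * r_sol t = tanh ?z"
      by (simp add: r_sol_def)
    moreover have "4 * r_sol t = sqrt 2 * tanh ?z"
      by (simp add: r_sol_def field_simps)
    moreover have "8 * t = 3 * sqrt 2 * ?z - sqrt 2 * tanh ?z"
      using arc_fun_arc_inv[of "8 * t"] by (simp only: arc_fun_def)
    ultimately show ?thesis
      by (simp add: artanh_tanh_real)
  qed
  then show "r_implicit r"
    using r r_sol_range by (simp add: r_implicit_def r_range_def)
qed

lemma has_real_derivative_cong_Ici: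
  fixes f g :: "real \<Rightarrow> real"
  assumes "(g has_real_derivative D) (at t within {0..})" "\<And>t. 0 \<le> t \<Longrightarrow> f t = g t" "0 \<le> t"
  shows "(f has_real_derivative D) (at t within {0..})"
  using has_field_derivative_transform_within[of g D t "{0..}" 1 f] assms by auto

lemma one_plus_4_sq_pos: "0 < 1 + 4 * (x::real)\<^sup>2"
  by (simp add: add_pos_nonneg)

lemma r_ode_iff: "r_ode r \<longleftrightarrow> (\<forall>t\<ge>0. r t = r_sol t)"
proof
  assume r: "r_ode r"
  \<comment> \<open>The left-hand side of the implicit equation is a first integral: its derivative
    along r has numerator \<open>8 (1 + 4 r^2) + 4 (1 - 8 r^2) - 12 = 0\<close> over
    \<open>1 + 4 r^2\<close>.\<close>
  define k where "k t = 8 * t + 4 * r t - 3 * sqrt 2 * artanh (2 * sqrt 2 * r t)" for t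
  have range: "r_range r"
    using r by (simp add: r_ode_def)
  \<comment> \<open>The zero derivative is written as a product to match
    \<open>linear_ode_zero\<close> with zero coefficient.\<close>
  have "(k has_real_derivative 0 * k t) (at t within {0..})" if t: "0 \<le> t" for t
  proof -
    let ?D = "(1 - 8 * (r t)\<^sup>2) / (1 + 4 * (r t)\<^sup>2)"
    have D: "(r has_real_derivative ?D) (at t within {0..})"
      using r t by (simp add: r_ode_def)
    have "0 \<le> r t" "r t < 1 / (2 * sqrt 2)"
      using range t by (auto simp: r_range_def)
    then have lt: "\<bar>2 * sqrt 2 * r t\<bar> < 1"
      by (auto simp: field_simps abs_mult)
    then have "(2 * sqrt 2 * r t)\<^sup>2 < 1"
      by (simp add: abs_square_less_1)
    then have sq: "1 - 8 * (r t)\<^sup>2 > 0"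
      by (simp add: power_mult_distrib)
    have "((\<lambda>t. artanh (2 * sqrt 2 * r t)) has_real_derivative
        1 / (1 - (2 * sqrt 2 * r t)\<^sup>2) * (2 * sqrt 2 * ?D)) (at t within {0..})"
      by (rule DERIV_chain2[OF artanh_real_has_field_derivative[OF lt] DERIV_cmult[OF D]])
    \<comment> \<open>The factor \<open>1 - 8 r^2\<close> cancels between the derivatives of
      \<open>artanh\<close> and of r; the range makes it nonzero.\<close>
    then have "((\<lambda>t. artanh (2 * sqrt 2 * r t)) has_real_derivative
        2 * sqrt 2 / (1 + 4 * (r t)\<^sup>2)) (at t within {0..})"
      using sq by (simp add: power_mult_distrib)
    then have "(k has_real_derivative
        8 + 4 * ?D - 3 * sqrt 2 * (2 * sqrt 2 / (1 + 4 * (r t)\<^sup>2))) (at t within {0..})"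
      unfolding k_def[abs_def]
      by (intro DERIV_diff DERIV_add DERIV_cmult D) (auto intro!: derivative_eq_intros)
    moreover have "8 + 4 * ?D - 3 * sqrt 2 * (2 * sqrt 2 / (1 + 4 * (r t)\<^sup>2)) = 0"
      using one_plus_4_sq_pos[of "r t"] by (simp add: divide_simps)
    ultimately show ?thesis
      by simp
  qed
  moreover have "k 0 = 0"
    using r by (simp add: k_def r_ode_def)
  ultimately have "k t = 0" if "0 \<le> t" for t
    using linear_ode_zero[of "\<lambda>_. 0" k t] that by simp
  then have "r_implicit r"
    using range by (simp add: r_implicit_def k_def)
  then show "\<forall>t\<ge>0. r t = r_sol t"
    by (simp add: r_implicit_iff)
next
  assume r: "\<forall>t\<ge>0. r t = r_sol t"
  have "(r has_real_derivative (1 - 8 * (r t)\<^sup>2) / (1 + 4 * (r t)\<^sup>2)) (at t within {0..})"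
    if "0 \<le> t" for t
    using has_real_derivative_cong_Ici[OF has_field_derivative_at_within[OF r_sol_has_real_derivative]]
      r that by simp
  then show "r_ode r"
    using r r_sol_range by (simp add: r_ode_def r_range_def)
qed

text \<open>Serves the uniqueness proof, where r arises as a quotient of unknown functions with no
  bounds known in advance. Positivity of \<open>1 - 8 r^2\<close> gives the upper bound and, making
  r increasing, the lower one.\<close>

lemma r_odeI_without_range:
  assumes "r 0 = 0"
    and r: "\<And>t. 0 \<le> t \<Longrightarrow>
      (r has_real_derivative (1 - 8 * (r t)\<^sup>2) / (1 + 4 * (r t)\<^sup>2)) (at t within {0..})"
  shows "r_ode r"
proof -
  have cont: "continuous_on {0..} r"
    using r by (intro DERIV_continuous_on) auto
  have nz: "1 + 4 * (r t)\<^sup>2 \<noteq> 0" for t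
    using one_plus_4_sq_pos[of "r t"] by simp
  \<comment> \<open>\<open>1 - 8 r\<^sup>2\<close> solves a homogeneous linear equation, so \<open>r\<close> cannot reach \<open>1 / (2 \<surd>2)\<close>.\<close>
  have pos: "0 < 1 - 8 * (r t)\<^sup>2" if "0 \<le> t" for t
  proof (rule linear_ode_pos[where f = "\<lambda>t. 1 - 8 * (r t)\<^sup>2"])
    show "continuous_on {0..} (\<lambda>t. - 16 * r t / (1 + 4 * (r t)\<^sup>2))"
      using cont nz by (intro continuous_intros) auto
    show "((\<lambda>t. 1 - 8 * (r t)\<^sup>2) has_real_derivative
        - 16 * r t / (1 + 4 * (r t)\<^sup>2) * (1 - 8 * (r t)\<^sup>2)) (at t within {0..})" if "0 \<le> t" for t
      by (rule derivative_eq_intros r that refl)+ simp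
  qed (use that \<open>r 0 = 0\<close> in auto)
  have "0 \<le> r t \<and> r t < 1 / (2 * sqrt 2)" if t: "0 \<le> t" for t
  proof
    have "r 0 \<le> r t"
    proof (rule DERIV_nonneg_imp_increasing_open[OF t])
      \<comment> \<open>At interior points the one-sided derivative is a full one; continuity covers
        the endpoints.\<close>
      show "\<exists>D. DERIV r x :> D \<and> 0 \<le> D" if "0 < x" "x < t" for x
      proof (intro exI conjI)
        show "DERIV r x :> (1 - 8 * (r x)\<^sup>2) / (1 + 4 * (r x)\<^sup>2)"
          using r[of x] that at_within_interior[of x "{0..}"] by (simp add: interior_real_atLeast)
        show "0 \<le> (1 - 8 * (r x)\<^sup>2) / (1 + 4 * (r x)\<^sup>2)"
          using pos[of x] one_plus_4_sq_pos[of "r x"] that by simp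
      qed
      show "continuous_on {0..t} r"
        using cont by (rule continuous_on_subset) auto
    qed
    then show "0 \<le> r t"
      using \<open>r 0 = 0\<close> by simp
    have "(2 * sqrt 2 * r t)\<^sup>2 < 1"
      using pos[OF t] by (simp add: power_mult_distrib)
    then have "2 * sqrt 2 * r t < 1"
      by (simp add: abs_square_less_1 abs_less_iff)
    then show "r t < 1 / (2 * sqrt 2)"
      by (simp add: field_simps)
  qed
  then show ?thesis
    using assms by (simp add: r_ode_def r_range_def)
qed

text \<open>Values at negative times do not affect derivatives within \<open>{0..}\<close>. This
  bridges the explicit formulas, asserted for t >= 0 only, and functions on the whole line.\<close>

lemma ivp_solution_cong:
  assumes ivp: "ivp_solution q0 q1 x0 x1 x2 y00 y01 y10 y11"
    and eq: "\<And>t. 0 \<le> t \<Longrightarrow> q0' t = q0 t \<and> q1' t = q1 t \<and> x0' t = x0 t \<and> x1' t = x1 t \<and> x2' t = x2 t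
      \<and> y00' t = y00 t \<and> y01' t = y01 t \<and> y10' t = y10 t \<and> y11' t = y11 t"
  shows "ivp_solution q0' q1' x0' x1' x2' y00' y01' y10' y11'"
proof -
  have *: "(f' has_real_derivative D) (at t within {0..}) \<longleftrightarrow> (f has_real_derivative D) (at t within {0..})"
    if "\<And>t. 0 \<le> t \<Longrightarrow> f' t = f t" "0 \<le> t" for f f' D t
    using has_real_derivative_cong_Ici[of f D t f'] has_real_derivative_cong_Ici[of f' D t f] that by auto
  have "(F' has_real_derivative D) (at t within {0..}) \<longleftrightarrow> (F has_real_derivative D) (at t within {0..})"
    if "0 \<le> t" "(F', F) \<in> {(q0', q0), (q1', q1), (x0', x0), (x1', x1), (x2', x2), (y00', y00), (y01', y01), (y10', y10), (y11', y11)}" for F' F D t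
    using that by (intro *) (auto simp: eq)
  note deriv = this
  show ?thesis
    using ivp unfolding ivp_solution_def Let_def
    by (simp add: eq deriv[of _ q0' q0] deriv[of _ q1' q1] deriv[of _ x0' x0] deriv[of _ x1' x1] deriv[of _ x2' x2] deriv[of _ y00' y00] deriv[of _ y01' y01] deriv[of _ y10' y10] deriv[of _ y11' y11])
qed

section \<open>The explicit functions solve the system\<close>

text \<open>With \<open>p = 1 + 4 r^2\<close> and \<open>E = exp (- 4 t^2)\<close> one has
  \<open>q = p E / 2\<close> and \<open>y = 4 t p E\<close>, so each equation becomes a rational
  identity in r, t and E.\<close>

lemma ivp_solution_explicit:
  assumes r: "r_ode r"
  shows "ivp_solution (\<lambda>t. 1 / 2 * exp (- 4 * t\<^sup>2)) (\<lambda>t. 1 / 2 * (4 * (r t)\<^sup>2) * exp (- 4 * t\<^sup>2))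
    (\<lambda>t. exp (- 8 * t\<^sup>2)) (\<lambda>t. 8 * (r t)\<^sup>2 * exp (- 8 * t\<^sup>2)) (\<lambda>t. 16 * (r t) ^ 4 * exp (- 8 * t\<^sup>2))
    (\<lambda>t. 4 * r t * exp (- 4 * t\<^sup>2)) (\<lambda>t. 16 * (r t) ^ 3 * exp (- 4 * t\<^sup>2))
    (\<lambda>t. 4 * (t - r t) * exp (- 4 * t\<^sup>2)) (\<lambda>t. 16 * (r t)\<^sup>2 * (t - r t) * exp (- 4 * t\<^sup>2))"
proof -
  define p where "p t = 1 + 4 * (r t)\<^sup>2" for t
  define E where "E t = exp (- 4 * t\<^sup>2)" for t :: real
  have p: "p t > 0" for t
    by (simp add: p_def add_pos_nonneg)
  have D: "(r has_real_derivative (1 - 8 * (r t)\<^sup>2) / p t) (at t within {0..})" if "0 \<le> t" for t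
    using r that by (simp add: r_ode_def p_def)
  have E: "exp (- 4 * t\<^sup>2) = E t" "exp (- 8 * t\<^sup>2) = E t * E t" "E t > 0" for t :: real
    unfolding E_def by (simp_all flip: exp_add)
  have DE: "(E has_real_derivative - 8 * t * E t) (at t within {0..})" for t
    unfolding E_def[abs_def] by (auto intro!: derivative_eq_intros)
  have q: "1 / 2 * E t + 1 / 2 * (4 * (r t)\<^sup>2) * E t = p t * E t / 2" for t
    by (simp add: p_def algebra_simps)
  have y: "4 * r t * E t + 16 * (r t) ^ 3 * E t + 4 * (t - r t) * E t + 16 * (r t)\<^sup>2 * (t - r t) * E t
      = 4 * t * p t * E t" for t
    by (simp add: p_def algebra_simps power2_eq_square power3_eq_cube)
  show ?thesis
    unfolding ivp_solution_def Let_def E(1,2) q y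
  \<comment> \<open>Goals 1 to 9 are the initial values, settled at the end; goal 10 is the
    nonvanishing of q, and goals 11 to 19 are the nine equations in order.\<close>
  proof (intro conjI allI impI, goal_cases)
    case (10 t)
    then show ?case
      using p[of t] E(3)[of t] by simp
  next
    case (11 t)
    show ?case
      by (rule derivative_eq_intros D DE 11 refl)+
        (use p[of t] E(3)[of t] in \<open>simp_all add: divide_simps\<close>,
          simp add: p_def algebra_simps power2_eq_square power3_eq_cube power4_eq_xxxx)
  next
    case (12 t)
    show ?case
      by (rule derivative_eq_intros D DE 12 refl)+
        (use p[of t] E(3)[of t] in \<open>simp_all add: divide_simps\<close>,
          simp add: p_def algebra_simps power2_eq_square power3_eq_cube power4_eq_xxxx)
  next
    case (13 t)
    show ?case
      by (rule derivative_eq_intros D DE 13 refl)+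
        (use p[of t] E(3)[of t] in \<open>simp_all add: divide_simps\<close>)
  next
    case (14 t)
    show ?case
      by (rule derivative_eq_intros D DE 14 refl)+
        (use p[of t] E(3)[of t] in \<open>simp_all add: divide_simps\<close>,
          simp add: p_def algebra_simps power2_eq_square power3_eq_cube power4_eq_xxxx)
  next
    case (15 t)
    show ?case
      by (rule derivative_eq_intros D DE 15 refl)+
        (use p[of t] E(3)[of t] in \<open>simp_all add: divide_simps\<close>,
          simp add: p_def algebra_simps power2_eq_square power3_eq_cube power4_eq_xxxx)
  next
    case (16 t)
    show ?case
      by (rule derivative_eq_intros D DE 16 refl)+
        (use p[of t] E(3)[of t] in \<open>simp_all add: divide_simps\<close>,
          simp add: p_def algebra_simps power2_eq_square power3_eq_cube power4_eq_xxxx)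
  next
    case (17 t)
    show ?case
      by (rule derivative_eq_intros D DE 17 refl)+
        (use p[of t] E(3)[of t] in \<open>simp_all add: divide_simps\<close>,
          simp add: p_def algebra_simps power2_eq_square power3_eq_cube power4_eq_xxxx)
  next
    case (18 t)
    show ?case
      by (rule derivative_eq_intros D DE 18 refl)+
        (use p[of t] E(3)[of t] in \<open>simp_all add: divide_simps\<close>,
          simp add: p_def algebra_simps power2_eq_square power3_eq_cube power4_eq_xxxx)
  next
    case (19 t)
    show ?case
      by (rule derivative_eq_intros D DE 19 refl)+
        (use p[of t] E(3)[of t] in \<open>simp_all add: divide_simps\<close>,
          simp add: p_def algebra_simps power2_eq_square power3_eq_cube power4_eq_xxxx)
  qed (use r in \<open>simp_all add: r_ode_def E_def\<close>)
qed

section \<open>Uniqueness: every solution has the explicit form\<close>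

lemma ivp_solution_unique:
  assumes "ivp_solution q0 q1 x0 x1 x2 y00 y01 y10 y11"
  obtains r where "r_ode r"
    and "\<And>t. 0 \<le> t \<Longrightarrow>
           q0 t = 1 / 2 * exp (- 4 * t\<^sup>2) \<and>
           q1 t = 1 / 2 * (4 * (r t)\<^sup>2) * exp (- 4 * t\<^sup>2) \<and>
           x0 t = exp (- 8 * t\<^sup>2) \<and>
           x1 t = 8 * (r t)\<^sup>2 * exp (- 8 * t\<^sup>2) \<and>
           x2 t = 16 * (r t) ^ 4 * exp (- 8 * t\<^sup>2) \<and>
           y00 t = 4 * r t * exp (- 4 * t\<^sup>2) \<and>
           y01 t = 16 * (r t) ^ 3 * exp (- 4 * t\<^sup>2) \<and>
           y10 t = 4 * (t - r t) * exp (- 4 * t\<^sup>2) \<and>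
           y11 t = 16 * (r t)\<^sup>2 * (t - r t) * exp (- 4 * t\<^sup>2)"
proof -
  define q where "q t = q0 t + q1 t" for t
  define y where "y t = y00 t + y01 t + y10 t + y11 t" for t
  \<comment> \<open>Since q does not vanish, the ratios u and v are continuous and can serve as
    coefficients of linear equations.\<close>
  define u where "u t = y00 t / q t" for t
  define v where "v t = y t / q t" for t
  note ivp = assms[unfolded ivp_solution_def Let_def, folded q_def y_def]
  have init: "q0 0 = 1 / 2" "q1 0 = 0" "x0 0 = 1" "x1 0 = 0" "x2 0 = 0"
    "y00 0 = 0" "y01 0 = 0" "y10 0 = 0" "y11 0 = 0"
    using ivp by auto
  have q: "q t \<noteq> 0" if "0 \<le> t" for t
    using ivp that by auto
  have
    Dq0: "(q0 has_real_derivative - y00 t - y10 t) (at t within {0..})" and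
    Dq1: "(q1 has_real_derivative - y01 t - y11 t + (q0 t - 2 * q1 t) * u t) (at t within {0..})" and
    Dx0: "(x0 has_real_derivative - 2 * v t * x0 t) (at t within {0..})" and
    Dx1: "(x1 has_real_derivative 2 * u t * x0 t - 2 * (v t + u t) * x1 t) (at t within {0..})" and
    Dx2: "(x2 has_real_derivative u t * x1 t - 2 * (v t + 2 * u t) * x2 t) (at t within {0..})" and
    Dy00: "(y00 has_real_derivative 2 * x0 t / q t - y00 t * (u t + v t)) (at t within {0..})" and
    Dy01: "(y01 has_real_derivative x1 t / q t + y00 t * u t - y01 t * (v t + 3 * u t))
      (at t within {0..})" and
    Dy10: "(y10 has_real_derivative x1 t / q t + y00 t * u t - y10 t * v t) (at t within {0..})" and
    Dy11: "(y11 has_real_derivative 2 * x2 t / q t + (y01 t + y10 t) * u t - y11 t * (v t + 2 * u t))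
      (at t within {0..})"
    if "0 \<le> t" for t
    using ivp that unfolding u_def v_def
    by (auto elim!: DERIV_cong simp: power2_eq_square divide_simps) (auto simp: algebra_simps)
  have cont: "continuous_on {0..} q0" "continuous_on {0..} q1" "continuous_on {0..} x0" "continuous_on {0..} x1"
     "continuous_on {0..} y00" "continuous_on {0..} y01" "continuous_on {0..} y10" "continuous_on {0..} y11"
    using Dq0 Dq1 Dx0 Dx1 Dy00 Dy01 Dy10 Dy11 by (auto intro!: DERIV_continuous_on)
  have cont_u: "continuous_on {0..} u" and cont_v: "continuous_on {0..} v"
    unfolding u_def[abs_def] v_def[abs_def]
    using q unfolding q_def[abs_def] y_def[abs_def] by (auto intro!: continuous_intros cont)

  have x0_pos: "0 < x0 t" if "0 \<le> t" for t
    by (rule linear_ode_pos[of "\<lambda>t. - 2 * v t"])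
      (use that Dx0 init in \<open>auto intro!: continuous_intros cont_v\<close>)

  \<comment> \<open>This is the discriminant of \<open>x0 + x1 z + x2 z^2\<close>. Once it vanishes,
    the polynomial is \<open>x0 (1 + s z)^2\<close>, and the single ratio s describes all three
    coefficients.\<close>
  have disc: "(x1 t)\<^sup>2 - 4 * x0 t * x2 t = 0" if "0 \<le> t" for t
  proof (rule linear_ode_zero[where f = "\<lambda>t. (x1 t)\<^sup>2 - 4 * x0 t * x2 t" and a = "\<lambda>t. - 4 * (v t + u t)"])
    show "((\<lambda>t. (x1 t)\<^sup>2 - 4 * x0 t * x2 t) has_real_derivative
        - 4 * (v t + u t) * ((x1 t)\<^sup>2 - 4 * x0 t * x2 t)) (at t within {0..})" if "0 \<le> t" for t
      by (rule derivative_eq_intros Dx0 Dx1 Dx2 that refl)+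
        (simp add: algebra_simps power2_eq_square)
  qed (use that init in \<open>auto intro!: continuous_intros cont_u cont_v\<close>)

  define s where "s t = x1 t / (2 * x0 t)" for t
  have x1: "x1 t = 2 * s t * x0 t" if "0 \<le> t" for t
    using x0_pos[OF that] by (simp add: s_def)
  have x2: "x2 t = (s t)\<^sup>2 * x0 t" if "0 \<le> t" for t
  proof -
    have "4 * x0 t * x2 t = 4 * x0 t * ((s t)\<^sup>2 * x0 t)"
      using disc[OF that] x1[OF that] by algebra
    moreover have "4 * x0 t \<noteq> 0"
      using x0_pos[OF that] by simp
    ultimately show ?thesis
      using mult_left_cancel by blast
  qed
  \<comment> \<open>The terms in v cancel because they scale x0 and x1 alike.\<close>
  have Ds: "(s has_real_derivative u t * (1 - 2 * s t)) (at t within {0..})" if "0 \<le> t" for t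
    unfolding s_def[abs_def]
    by (rule derivative_eq_intros Dx0 Dx1 that refl)+
      (use x0_pos[OF that] in \<open>auto simp: divide_simps\<close>, simp add: algebra_simps)

  have y01: "y01 t = s t * y00 t" if "0 \<le> t" for t
  proof -
    have "y01 t - s t * y00 t = 0"
    \<comment> \<open>The relation \<open>x1 = 2 s x0\<close> cancels the source terms
      \<open>x1 / q\<close> and \<open>2 s x0 / q\<close>, leaving a homogeneous equation.\<close>
    proof (rule linear_ode_zero[where f = "\<lambda>t. y01 t - s t * y00 t" and a = "\<lambda>t. - (v t + 3 * u t)"])
      show "((\<lambda>t. y01 t - s t * y00 t) has_real_derivative
          - (v t + 3 * u t) * (y01 t - s t * y00 t)) (at t within {0..})" if "0 \<le> t" for t
        by (rule derivative_eq_intros Dy00 Dy01 Ds that refl)+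
          (simp add: x1[OF that] algebra_simps)
    qed (use that init in \<open>auto intro!: continuous_intros cont_u cont_v simp: s_def\<close>)
    then show ?thesis
      by simp
  qed
  have y11: "y11 t = s t * y10 t" if "0 \<le> t" for t
  proof -
    have "y11 t - s t * y10 t = 0"
    proof (rule linear_ode_zero[where f = "\<lambda>t. y11 t - s t * y10 t" and a = "\<lambda>t. - (v t + 2 * u t)"])
      show "((\<lambda>t. y11 t - s t * y10 t) has_real_derivative
          - (v t + 2 * u t) * (y11 t - s t * y10 t)) (at t within {0..})" if "0 \<le> t" for t
        by (rule derivative_eq_intros Dy10 Dy11 Ds that refl)+
          (simp add: x1[OF that] x2[OF that] y01[OF that] algebra_simps power2_eq_square)
    qed (use that init in \<open>auto intro!: continuous_intros cont_u cont_v simp: s_def\<close>)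
    then show ?thesis
      by simp
  qed
  have q1: "q1 t = s t * q0 t" if "0 \<le> t" for t
  proof -
    have "q1 t - s t * q0 t = 0"
    proof (rule linear_ode_zero[where f = "\<lambda>t. q1 t - s t * q0 t" and a = "\<lambda>t. - 2 * u t"])
      show "((\<lambda>t. q1 t - s t * q0 t) has_real_derivative
          - 2 * u t * (q1 t - s t * q0 t)) (at t within {0..})" if "0 \<le> t" for t
        by (rule derivative_eq_intros Dq0 Dq1 Ds that refl)+
          (simp add: y01[OF that] y11[OF that] algebra_simps)
    qed (use that init in \<open>auto intro!: continuous_intros cont_u simp: s_def\<close>)
    then show ?thesis
      by simp
  qed

  \<comment> \<open>Both q and y carry the factor \<open>1 + s\<close>, which drops out of v. As q
    is nonzero, neither this factor nor q0 vanishes.\<close>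
  have q_eq: "q t = (1 + s t) * q0 t" if "0 \<le> t" for t
    using q1[OF that] by (simp add: q_def algebra_simps)
  have y_eq: "y t = (1 + s t) * (y00 t + y10 t)" if "0 \<le> t" for t
    using y01[OF that] y11[OF that] by (simp add: y_def algebra_simps)
  have q0_nz: "q0 t \<noteq> 0" and s_nz: "1 + s t \<noteq> 0" if "0 \<le> t" for t
    using q[OF that] q_eq[OF that] by auto
  have v_eq: "v t = (y00 t + y10 t) / q0 t" if "0 \<le> t" for t
    using q_eq[OF that] y_eq[OF that] s_nz[OF that] by (simp add: v_def)
  have Dq0': "(q0 has_real_derivative - v t * q0 t) (at t within {0..})" if "0 \<le> t" for t
    using Dq0[OF that] v_eq[OF that] q0_nz[OF that] by simp

  \<comment> \<open>Both x0 and \<open>q0^2\<close> decay at rate \<open>2 v\<close>; the factor 4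
    comes from the initial values 1 and 1/2.\<close>
  have x0: "x0 t = 4 * (q0 t)\<^sup>2" if "0 \<le> t" for t
  proof -
    have "x0 t - 4 * (q0 t)\<^sup>2 = 0"
    proof (rule linear_ode_zero[where f = "\<lambda>t. x0 t - 4 * (q0 t)\<^sup>2" and a = "\<lambda>t. - 2 * v t"])
      show "((\<lambda>t. x0 t - 4 * (q0 t)\<^sup>2) has_real_derivative
          - 2 * v t * (x0 t - 4 * (q0 t)\<^sup>2)) (at t within {0..})" if "0 \<le> t" for t
        by (rule derivative_eq_intros Dx0 Dq0' that refl)+
          (simp add: algebra_simps power2_eq_square)
    qed (use that in \<open>auto intro!: continuous_intros cont_v simp: init power2_eq_square\<close>)
    then show ?thesis
      by simp
  qed

  \<comment> \<open>The source of \<open>y00 + y10\<close> is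
    \<open>(2 x0 + x1) / q = 2 x0 / q0 = 8 q0\<close>. Its decay rate v equals that of q0, so the
    quotient grows at constant rate 8.\<close>
  have v: "v t = 8 * t" if "0 \<le> t" for t
  proof -
    have "(y00 t + y10 t) / q0 t - 8 * t = 0"
    proof (rule linear_ode_zero[where f = "\<lambda>t. (y00 t + y10 t) / q0 t - 8 * t" and a = "\<lambda>t. 0"])
      show "((\<lambda>t. (y00 t + y10 t) / q0 t - 8 * t) has_real_derivative
          0 * ((y00 t + y10 t) / q0 t - 8 * t)) (at t within {0..})" if t: "0 \<le> t" for t
      proof -
        have D: "((\<lambda>t. y00 t + y10 t) has_real_derivative 8 * q0 t - v t * (y00 t + y10 t)) (at t within {0..})"
          by (rule derivative_eq_intros Dy00 Dy10 t refl)+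
            (use q0_nz[OF t] s_nz[OF t] in
              \<open>simp add: x1[OF t] x0[OF t] q_eq[OF t] divide_simps power2_eq_square\<close>,
              simp add: algebra_simps)
        show ?thesis
          by (rule derivative_eq_intros D Dq0' t refl q0_nz)+
            (use q0_nz[OF t] in \<open>simp add: divide_simps\<close>, simp add: algebra_simps)
      qed
    qed (use that init in \<open>auto intro!: continuous_intros\<close>)
    then show ?thesis
      using v_eq[OF that] by simp
  qed

  have q0: "q0 t = 1 / 2 * exp (- 4 * t\<^sup>2)" if "0 \<le> t" for t
  proof -
    define E where "E t = exp (- 4 * t\<^sup>2)" for t :: real
    have DE: "(E has_real_derivative - 8 * t * E t) (at t within {0..})" for t
      unfolding E_def[abs_def] by (auto intro!: derivative_eq_intros)
    have "q0 t - 1 / 2 * E t = 0"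
    proof (rule linear_ode_zero[where f = "\<lambda>t. q0 t - 1 / 2 * E t" and a = "\<lambda>t. - 8 * t"])
      show "((\<lambda>t. q0 t - 1 / 2 * E t) has_real_derivative - 8 * t * (q0 t - 1 / 2 * E t)) (at t within {0..})"
        if "0 \<le> t" for t
        by (rule derivative_eq_intros Dq0' DE that refl)+ (simp add: v[OF that] algebra_simps)
    qed (use that init in \<open>auto intro!: continuous_intros simp: E_def\<close>)
    then show ?thesis
      by (simp add: E_def)
  qed

  \<comment> \<open>The choice is forced by the claimed \<open>y00 = 4 r exp (- 4 t^2)\<close> and
    \<open>q0 = exp (- 4 t^2) / 2\<close>.\<close>
  define r where "r t = y00 t / (8 * q0 t)" for t
  have y00: "y00 t = 8 * r t * q0 t" if "0 \<le> t" for t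
    using q0_nz[OF that] by (simp add: r_def)
  have u: "u t = 8 * r t / (1 + s t)" if "0 \<le> t" for t
    using q0_nz[OF that] s_nz[OF that] by (simp add: u_def y00[OF that] q_eq[OF that])
  have Dr: "(r has_real_derivative (1 - 8 * (r t)\<^sup>2) / (1 + s t)) (at t within {0..})" if t: "0 \<le> t" for t
  proof -
    have D: "(y00 has_real_derivative 8 * q0 t / (1 + s t) - y00 t * (u t + v t)) (at t within {0..})"
      using Dy00[OF t] q0_nz[OF t] s_nz[OF t]
      by (simp add: x0[OF t] q_eq[OF t] power2_eq_square)
    show ?thesis
      unfolding r_def[abs_def]
      by (rule derivative_eq_intros D Dq0' t refl q0_nz)+
        (use q0_nz[OF t] s_nz[OF t] in \<open>auto simp: y00[OF t] u[OF t] divide_simps\<close>,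
          simp add: algebra_simps power2_eq_square)
  qed
  have cont_r: "continuous_on {0..} r" and cont_s: "continuous_on {0..} s"
    using Dr Ds by (auto intro!: DERIV_continuous_on)
  \<comment> \<open>Here \<open>s' = 8 r (1 - 2 s) / (1 + s)\<close> and
    \<open>(4 r^2)' = 8 r (1 - 8 r^2) / (1 + s)\<close>, so the difference is proportional to
    \<open>s - 4 r^2\<close>. Its vanishing turns \<open>Dr\<close> into the scalar equation for
    r.\<close>
  have s: "s t = 4 * (r t)\<^sup>2" if "0 \<le> t" for t
  proof -
    have "s t - 4 * (r t)\<^sup>2 = 0"
    proof (rule linear_ode_zero[where f = "\<lambda>t. s t - 4 * (r t)\<^sup>2" and a = "\<lambda>t. - 16 * r t / (1 + s t)"])
      show "((\<lambda>t. s t - 4 * (r t)\<^sup>2) has_real_derivative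
          - 16 * r t / (1 + s t) * (s t - 4 * (r t)\<^sup>2)) (at t within {0..})" if t: "0 \<le> t" for t
        by (rule derivative_eq_intros Dr Ds t refl)+
          (use s_nz[OF t] in \<open>simp add: u[OF t] divide_simps\<close>, simp add: algebra_simps power2_eq_square)
      show "continuous_on {0..} (\<lambda>t. - 16 * r t / (1 + s t))"
        using s_nz by (auto intro!: continuous_intros cont_r cont_s)
    qed (use that init in \<open>auto simp: s_def r_def\<close>)
    then show ?thesis
      by simp
  qed
  show thesis
  proof
    show "r_ode r"
      by (rule r_odeI_without_range) (use init Dr s in \<open>auto simp: r_def\<close>)
    fix t :: real
    assume t: "0 \<le> t"
    \<comment> \<open>Expressing both exponentials through q0 turns the nine formulas into
      polynomial identities in q0, r and t.\<close>
    have E4: "exp (- 4 * t\<^sup>2) = 2 * q0 t"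
      using q0[OF t] by simp
    have E8: "exp (- 8 * t\<^sup>2) = 4 * (q0 t)\<^sup>2"
      using exp_double[of "- 4 * t\<^sup>2"] unfolding E4 by simp
    have y10: "y10 t = 8 * t * q0 t - y00 t"
      using v_eq[OF t] v[OF t] q0_nz[OF t] by (simp add: nonzero_eq_divide_eq)
    show "q0 t = 1 / 2 * exp (- 4 * t\<^sup>2) \<and>
           q1 t = 1 / 2 * (4 * (r t)\<^sup>2) * exp (- 4 * t\<^sup>2) \<and>
           x0 t = exp (- 8 * t\<^sup>2) \<and>
           x1 t = 8 * (r t)\<^sup>2 * exp (- 8 * t\<^sup>2) \<and>
           x2 t = 16 * (r t) ^ 4 * exp (- 8 * t\<^sup>2) \<and>
           y00 t = 4 * r t * exp (- 4 * t\<^sup>2) \<and>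
           y01 t = 16 * (r t) ^ 3 * exp (- 4 * t\<^sup>2) \<and>
           y10 t = 4 * (t - r t) * exp (- 4 * t\<^sup>2) \<and>
           y11 t = 16 * (r t)\<^sup>2 * (t - r t) * exp (- 4 * t\<^sup>2)"
      unfolding E4 E8 q1[OF t] x2[OF t] x1[OF t] x0[OF t] y11[OF t] y01[OF t] y10 y00[OF t] s[OF t]
      by (simp add: algebra_simps power2_eq_square power3_eq_cube power4_eq_xxxx)
  qed
qed

text \<open>The first two conjuncts guarantee that the quantification over \<open>r\<close> in the
  third is not vacuous.\<close>

theorem theorem3:
  "(\<exists>r. r_ode r) \<and>
   (\<forall>r. r_ode r \<longleftrightarrow> r_implicit r) \<and>
   (\<forall>r. r_implicit r \<longrightarrow>
     (\<forall>q0 q1 x0 x1 x2 y00 y01 y10 y11.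
        ivp_solution q0 q1 x0 x1 x2 y00 y01 y10 y11 \<longleftrightarrow>
        (\<forall>t\<ge>0.
           q0 t = 1 / 2 * exp (- 4 * t\<^sup>2) \<and>
           q1 t = 1 / 2 * (4 * (r t)\<^sup>2) * exp (- 4 * t\<^sup>2) \<and>
           x0 t = exp (- 8 * t\<^sup>2) \<and>
           x1 t = 8 * (r t)\<^sup>2 * exp (- 8 * t\<^sup>2) \<and>
           x2 t = 16 * (r t) ^ 4 * exp (- 8 * t\<^sup>2) \<and>
           y00 t = 4 * r t * exp (- 4 * t\<^sup>2) \<and>
           y01 t = 16 * (r t) ^ 3 * exp (- 4 * t\<^sup>2) \<and>
           y10 t = 4 * (t - r t) * exp (- 4 * t\<^sup>2) \<and>
           y11 t = 16 * (r t)\<^sup>2 * (t - r t) * exp (- 4 * t\<^sup>2))))"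
proof (intro conjI allI impI)
  show "\<exists>r. r_ode r"
    using r_ode_iff by blast
  show "r_ode r \<longleftrightarrow> r_implicit r" for r
    by (simp add: r_ode_iff r_implicit_iff)
next
  fix r q0 q1 x0 x1 x2 y00 y01 y10 y11
  assume "r_implicit r"
  then have r: "\<And>t. 0 \<le> t \<Longrightarrow> r t = r_sol t" and ode: "r_ode r"
    by (simp_all add: r_implicit_iff r_ode_iff)
  show "ivp_solution q0 q1 x0 x1 x2 y00 y01 y10 y11 \<longleftrightarrow>
        (\<forall>t\<ge>0.
           q0 t = 1 / 2 * exp (- 4 * t\<^sup>2) \<and>
           q1 t = 1 / 2 * (4 * (r t)\<^sup>2) * exp (- 4 * t\<^sup>2) \<and>
           x0 t = exp (- 8 * t\<^sup>2) \<and>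
           x1 t = 8 * (r t)\<^sup>2 * exp (- 8 * t\<^sup>2) \<and>
           x2 t = 16 * (r t) ^ 4 * exp (- 8 * t\<^sup>2) \<and>
           y00 t = 4 * r t * exp (- 4 * t\<^sup>2) \<and>
           y01 t = 16 * (r t) ^ 3 * exp (- 4 * t\<^sup>2) \<and>
           y10 t = 4 * (t - r t) * exp (- 4 * t\<^sup>2) \<and>
           y11 t = 16 * (r t)\<^sup>2 * (t - r t) * exp (- 4 * t\<^sup>2))"
    (is "_ \<longleftrightarrow> ?explicit")
  proof
    assume "ivp_solution q0 q1 x0 x1 x2 y00 y01 y10 y11"
    then show ?explicit
    proof (rule ivp_solution_unique)
      \<comment> \<open>The function extracted from the solution agrees with the given r for t >= 0,
        since both equal \<open>r_sol\<close> there.\<close>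
      fix r'
      assume "r_ode r'"
      then have "\<And>t. 0 \<le> t \<Longrightarrow> r' t = r t"
        by (simp add: r r_ode_iff)
      then show ?thesis if "\<And>t. 0 \<le> t \<Longrightarrow>
           q0 t = 1 / 2 * exp (- 4 * t\<^sup>2) \<and>
           q1 t = 1 / 2 * (4 * (r' t)\<^sup>2) * exp (- 4 * t\<^sup>2) \<and>
           x0 t = exp (- 8 * t\<^sup>2) \<and>
           x1 t = 8 * (r' t)\<^sup>2 * exp (- 8 * t\<^sup>2) \<and>
           x2 t = 16 * (r' t) ^ 4 * exp (- 8 * t\<^sup>2) \<and>
           y00 t = 4 * r' t * exp (- 4 * t\<^sup>2) \<and>
           y01 t = 16 * (r' t) ^ 3 * exp (- 4 * t\<^sup>2) \<and>
           y10 t = 4 * (t - r' t) * exp (- 4 * t\<^sup>2) \<and>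
           y11 t = 16 * (r' t)\<^sup>2 * (t - r' t) * exp (- 4 * t\<^sup>2)"
        using that by simp
    qed
  next
    assume ?explicit
    then show "ivp_solution q0 q1 x0 x1 x2 y00 y01 y10 y11"
      by (intro ivp_solution_cong[OF ivp_solution_explicit[OF ode]]) blast
  qed
qed

end
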